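(* Let $C(t,p,q)=\sum_{n\ge 0}t^n\sum_{P\in\mathcal{D}_n}p^{\mathrm{run}(P)}q^{\mathrm{ret}(P)}$. Then $$C(t,p,q)=\frac{2pq(1-t)-2(p+q)+4+2(p+q-pq-pqt)\sqrt{1-4t}}{(1-pqt)\left(2-p+p\sqrt{1-4t}\right)\left(2-q+q\sqrt{1-4t}\right)}.$$
   Context: For $n\ge 0$, $\mathcal{D}_n$ is the set of classical Dyck paths of size $n$: lattice paths from $(0,0)$ to $(n,n)$ with unit north steps $N$ and east steps $E$ staying weakly above the line $y=x$ ($\mathcal{D}_0$ consists of the empty path, with $\mathrm{run}=\mathrm{ret}=0$). For $P\in\mathcal{D}_n$ with $n\ge1$, let $u_i$ be the $x$-coordinate of the $i$-th north step of $P$ (bottom to top); $\mathrm{run}(P)=\min\{i\in\{1,\dots,n\}: i\notin\{u_1,\dots,u_n\}\}$ (the number of peaks before the first occurrence of two consecutive east steps), and $\mathrm{ret}(P)$ is the number of north steps of $P$ starting at a point $(i,i)$ on the diagonal, i.e. the number of returns of $P$ to the diagonal. The identity is of formal power series in $t$ (with the branch of $\sqrt{1-4t}$ equal to $1$ at $t=0$). *)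

theory Defs
  imports "HOL-Computational_Algebra.Formal_Power_Series"
begin

datatype step = North | East

definition xpos :: "step list \<Rightarrow> nat \<Rightarrow> nat" where
  "xpos P k = count_list (take k P) East"

definition ypos :: "step list \<Rightarrow> nat \<Rightarrow> nat" where
  "ypos P k = count_list (take k P) North"

text \<open>The path \<open>P\<close> starts at the origin and reaches \<open>(xpos P k, ypos P k)\<close> after \<open>k\<close> steps.\<close>

definition dyck_paths :: "nat \<Rightarrow> step list set" where
  "dyck_paths n =
     {P. (xpos P (length P), ypos P (length P)) = (n, n) \<and>
         (\<forall>k\<le>length P. xpos P k \<le> ypos P k)}"

text \<open>\<open>north_xs P ! (i - 1)\<close> is the \<open>x\<close>-coordinate \<open>u\<^sub>i\<close> of the \<open>i\<close>-th north step.\<close>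

definition north_xs :: "step list \<Rightarrow> nat list" where
  "north_xs P = map (xpos P) (filter (\<lambda>k. P ! k = North) [0..<length P])"

text \<open>
  For a Dyck path of size \<open>n \<ge> 1\<close> the list \<open>north_xs P\<close> has length \<open>n\<close>, and the set below is
  nonempty because it contains \<open>n\<close>: no north step lies on the line \<open>x = n\<close>.
\<close>

definition run :: "step list \<Rightarrow> nat" where
  "run P = (if P = [] then 0
            else Min {i \<in> {1..length (north_xs P)}. i \<notin> set (north_xs P)})"

definition ret :: "step list \<Rightarrow> nat" where
  "ret P = card {k. k < length P \<and> P ! k = North \<and> xpos P k = ypos P k}"

text \<open>
  The formal variable \<open>t\<close> is \<open>fps_X\<close>, while \<open>p\<close> and \<open>q\<close> are arbitrary elements of the
  coefficient field. The case of indeterminates \<open>p\<close> and \<open>q\<close> is the one where the field is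
  a field of rational functions in them.
\<close>

definition C_gf :: "'a::field_char_0 \<Rightarrow> 'a \<Rightarrow> 'a fps" where
  "C_gf p q = Abs_fps (\<lambda>n. \<Sum>P\<in>dyck_paths n. p ^ run P * q ^ ret P)"

text \<open>
  The square root of \<open>1 - 4t\<close> with constant coefficient \<open>1\<close>. The first argument of \<open>fps_radical\<close>
  prescribes the root of the constant coefficient.
\<close>

definition sqrt_1_minus_4t :: "'a::field_char_0 fps" where
  "sqrt_1_minus_4t = fps_radical (\<lambda>_ _. 1) 2 (1 - 4 * fps_X)"

lemma sqrt_1_minus_4t_nth_0: "fps_nth sqrt_1_minus_4t 0 = (1 :: 'a::field_char_0)"
  by (simp add: sqrt_1_minus_4t_def)

lemma sqrt_1_minus_4t_power2: "sqrt_1_minus_4t ^ 2 = (1 - 4 * fps_X :: 'a::field_char_0 fps)"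
  using power_radical[of "1 - 4 * fps_X :: 'a fps" "\<lambda>_ _. 1" 1]
  by (simp add: sqrt_1_minus_4t_def numeral_2_eq_2)

lemma count_list_North_East: "count_list P North + count_list P East = length P"
proof (induction P)
  case (Cons s P)
  then show ?case by (cases s) auto
qed simp

lemma finite_dyck_paths: "finite (dyck_paths n)"
proof (rule finite_subset)
  show "dyck_paths n \<subseteq> {P. set P \<subseteq> {North, East} \<and> length P = 2 * n}"
  proof
    fix P assume "P \<in> dyck_paths n"
    then have "length P = 2 * n"
      using count_list_North_East[of P] by (simp add: dyck_paths_def xpos_def ypos_def)
    then show "P \<in> {P. set P \<subseteq> {North, East} \<and> length P = 2 * n}"
      using step.exhaust by blast
  qed
  show "finite {P. set P \<subseteq> {North, East} \<and> length P = 2 * n}"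
    by (rule finite_lists_length_eq) simp
qed

end

theory Submission
  imports Defs
begin

text \<open>
  Every nonempty Dyck path is uniquely \<open>N A E B\<close> with Dyck paths \<open>A\<close> and \<open>B\<close>. Its number of returns
  is \<open>1 + ret B\<close>, and its run is \<open>run A\<close> if \<open>A\<close> is nonempty and \<open>1 + run B\<close> otherwise. Hence
  \<open>C(p,q) = 1 + p q t C(p,q) + q t (C(p,1) - 1) C(1,q)\<close>. With \<open>c = C(1,1)\<close>, the Catalan series, the
  specialisations at \<open>q = 1\<close> and \<open>p = 1\<close> give \<open>C(p,1) = 1 / (1 - p t c)\<close> and
  \<open>C(1,q) = 1 / (1 - q t c)\<close>, and \<open>sqrt (1 - 4 t) = 1 - 2 t c\<close>.
\<close>

section \<open>Dyck paths and their first-return decomposition\<close>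

text \<open>\<open>h\<close> is the current height above the diagonal. Tracking it step by step
  permits structural induction in place of the condition on all prefixes.\<close>

fun dyck_suffix :: "nat \<Rightarrow> step list \<Rightarrow> bool" where
  "dyck_suffix h [] \<longleftrightarrow> h = 0"
| "dyck_suffix h (North # P) \<longleftrightarrow> dyck_suffix (Suc h) P"
| "dyck_suffix 0 (East # P) \<longleftrightarrow> False"
| "dyck_suffix (Suc h) (East # P) \<longleftrightarrow> dyck_suffix h P"

lemma xpos_simps [simp]:
  "xpos P 0 = 0" "xpos [] k = 0"
  "xpos (North # P) (Suc k) = xpos P k" "xpos (East # P) (Suc k) = Suc (xpos P k)"
  by (simp_all add: xpos_def)

lemma ypos_simps [simp]:
  "ypos P 0 = 0" "ypos [] k = 0"
  "ypos (North # P) (Suc k) = Suc (ypos P k)" "ypos (East # P) (Suc k) = ypos P k"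
  by (simp_all add: ypos_def)

lemma all_le_Suc_iff: "(\<forall>k\<le>Suc n. Q k) \<longleftrightarrow> Q 0 \<and> (\<forall>k\<le>n. Q (Suc k))"
  by (metis Suc_le_mono le0 not0_implies_Suc)

lemma dyck_suffix_iff:
  "dyck_suffix h P \<longleftrightarrow> xpos P (length P) = ypos P (length P) + h \<and>
     (\<forall>k\<le>length P. xpos P k \<le> ypos P k + h)"
  by (induction h P rule: dyck_suffix.induct) (auto simp: all_le_Suc_iff)

lemma dyck_paths_iff: "P \<in> dyck_paths n \<longleftrightarrow> dyck_suffix 0 P \<and> count_list P North = n"
  by (auto simp: dyck_paths_def dyck_suffix_iff ypos_def)

lemma dyck_suffix_count: "dyck_suffix h P \<Longrightarrow> count_list P East = count_list P North + h"
  by (simp add: dyck_suffix_iff xpos_def ypos_def)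

text \<open>Raised by \<open>Suc h\<close>, the part \<open>A\<close> ends at height
  \<open>Suc h\<close> and stays at least that high, so the East step after it leads to height
  \<open>h\<close>.\<close>

lemma dyck_suffix_append_East:
  "dyck_suffix a A \<Longrightarrow> dyck_suffix (a + Suc h) (A @ East # B) \<longleftrightarrow> dyck_suffix h B"
  by (induction a A rule: dyck_suffix.induct) auto

text \<open>The cut is at the first step down to height \<open>h\<close>. After an initial North
  step two such cuts are needed, one from \<open>Suc (Suc h)\<close> and one from
  \<open>Suc h\<close>, hence the induction on length.\<close>

lemma dyck_suffix_split:
  "dyck_suffix (Suc h) P \<Longrightarrow> \<exists>A B. P = A @ East # B \<and> dyck_suffix 0 A \<and> dyck_suffix h B"
proof (induction "length P" arbitrary: P h rule: less_induct)
  case less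
  show ?case
  proof (cases P)
    case Nil
    with less.prems show ?thesis by simp
  next
    case (Cons s P')
    show ?thesis
    proof (cases s)
      case East
      with less.prems Cons have "P = [] @ East # P' \<and> dyck_suffix 0 [] \<and> dyck_suffix h P'"
        by simp
      then show ?thesis by blast
    next
      case North
      with less.prems Cons have "dyck_suffix (Suc (Suc h)) P'" by simp
      moreover have "length P' < length P" using Cons by simp
      ultimately obtain A B where
        A: "P' = A @ East # B" "dyck_suffix 0 A" "dyck_suffix (Suc h) B"
        using less.hyps by blast
      have "length B < length P" using Cons A by simp
      with A obtain A' B' where
        B: "B = A' @ East # B'" "dyck_suffix 0 A'" "dyck_suffix h B'"
        using less.hyps by blast
      have "dyck_suffix 0 (North # A @ East # A')"
        using A B dyck_suffix_append_East[of 0 A 0 A'] by simp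
      moreover have "P = (North # A @ East # A') @ East # B'"
        using Cons North A B by simp
      ultimately show ?thesis using B by blast
    qed
  qed
qed

text \<open>Each of \<open>A\<close> and \<open>A'\<close> ends at height 0, and the East step that
  follows would go below it; so neither can extend beyond the other.\<close>

lemma dyck_suffix_split_unique:
  assumes "dyck_suffix h A" "dyck_suffix h A'" "A @ East # B = A' @ East # B'"
  shows "A = A' \<and> B = B'"
  using assms
proof (induction h A arbitrary: A' rule: dyck_suffix.induct)
  case (1 h)
  then show ?case by (cases A') auto
next
  case (2 h P)
  from 2(3,4) obtain A'' where A'': "A' = North # A''" by (cases A') auto
  show ?case using "2.IH"[of A''] "2.prems" unfolding A'' by simp
next
  case (4 h P)
  from 4(3,4) obtain A'' where A'': "A' = East # A''" by (cases A') auto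
  show ?case using "4.IH"[of A''] "4.prems" unfolding A'' by simp
qed auto

definition join :: "step list \<times> step list \<Rightarrow> step list" where
  "join = (\<lambda>(A, B). North # A @ East # B)"

lemma inj_on_join: "inj_on join (dyck_paths i \<times> X)"
  by (auto simp: inj_on_def join_def dyck_paths_iff dest: dyck_suffix_split_unique)

lemma dyck_paths_0: "dyck_paths 0 = {[]}"
proof (intro equalityI subsetI)
  fix P assume "P \<in> dyck_paths 0"
  then have "length P = 0"
    using count_list_North_East[of P] dyck_suffix_count[of 0 P] by (simp add: dyck_paths_iff)
  then show "P \<in> {[]}" by simp
qed (simp add: dyck_paths_iff)

lemma dyck_paths_Suc:
  "dyck_paths (Suc n) = (\<Union>i\<le>n. join ` (dyck_paths i \<times> dyck_paths (n - i)))"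
proof (intro equalityI subsetI)
  fix P assume P: "P \<in> dyck_paths (Suc n)"
  then obtain P' where P': "P = North # P'" "dyck_suffix (Suc 0) P'"
    by (cases "(0::nat, P)" rule: dyck_suffix.cases) (auto simp: dyck_paths_iff)
  from dyck_suffix_split[OF P'(2)] obtain A B where
    "P' = A @ East # B" "dyck_suffix 0 A" "dyck_suffix 0 B" by blast
  with P P' have "P = join (A, B)" "A \<in> dyck_paths (count_list A North)"
    "B \<in> dyck_paths (n - count_list A North)" "count_list A North \<le> n"
    by (auto simp: dyck_paths_iff join_def)
  then show "P \<in> (\<Union>i\<le>n. join ` (dyck_paths i \<times> dyck_paths (n - i)))" by blast
next
  fix P assume "P \<in> (\<Union>i\<le>n. join ` (dyck_paths i \<times> dyck_paths (n - i)))"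
  then show "P \<in> dyck_paths (Suc n)"
    using dyck_suffix_append_East[of 0 _ 0] by (auto simp: dyck_paths_iff join_def)
qed

text \<open>Uniqueness of the splitting makes \<open>join\<close> injective and its images for
  different \<open>i\<close> disjoint.\<close>

lemma sum_dyck_paths_Suc:
  "(\<Sum>P\<in>dyck_paths (Suc n). f P) =
     (\<Sum>i\<le>n. \<Sum>A\<in>dyck_paths i. \<Sum>B\<in>dyck_paths (n - i). f (North # A @ East # B))"
proof -
  have "(\<Sum>P\<in>dyck_paths (Suc n). f P) =
      (\<Sum>i\<le>n. \<Sum>P\<in>join ` (dyck_paths i \<times> dyck_paths (n - i)). f P)"
    unfolding dyck_paths_Suc
  proof (rule sum.UNION_disjoint)
    show "\<forall>i\<in>{..n}. \<forall>j\<in>{..n}. i \<noteq> j \<longrightarrow>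
      join ` (dyck_paths i \<times> dyck_paths (n - i)) \<inter> join ` (dyck_paths j \<times> dyck_paths (n - j)) = {}"
      by (auto simp: join_def dyck_paths_iff dest: dyck_suffix_split_unique)
  qed (simp_all add: finite_dyck_paths)
  also have "\<dots> = (\<Sum>i\<le>n. \<Sum>A\<in>dyck_paths i. \<Sum>B\<in>dyck_paths (n - i). f (North # A @ East # B))"
    by (simp add: sum.reindex[OF inj_on_join] sum.cartesian_product) (simp add: join_def case_prod_beta)
  finally show ?thesis .
qed

section \<open>The run under the decomposition\<close>

lemma upt_0_Suc: "[0..<Suc n] = 0 # map Suc [0..<n]"
  by (simp add: map_Suc_upt upt_conv_Cons del: upt_Suc)

lemma north_xs_simps [simp]:
  "north_xs [] = []"
  "north_xs (North # P) = 0 # north_xs P"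
  "north_xs (East # P) = map Suc (north_xs P)"
  by (simp_all add: north_xs_def upt_0_Suc filter_map comp_def del: upt_Suc)

lemma north_xs_append:
  "north_xs (P @ Q) = north_xs P @ map ((+) (count_list P East)) (north_xs Q)"
proof (induction P)
  case (Cons s P)
  then show ?case by (cases s) auto
qed (simp add: map_idI)

lemma length_north_xs: "length (north_xs P) = count_list P North"
proof (induction P)
  case (Cons s P)
  then show ?case by (cases s) auto
qed simp

text \<open>After a North step the height is positive, so an East step must still follow; the bound
  is the total number of East steps.\<close>

lemma north_xs_less_add:
  "dyck_suffix h P \<Longrightarrow> x \<in> set (north_xs P) \<Longrightarrow> x < count_list P North + h"
  by (induction h P arbitrary: x rule: dyck_suffix.induct) fastforce+

lemmas north_xs_less = north_xs_less_add[of 0, simplified]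

lemma zero_in_north_xs: "dyck_suffix 0 P \<Longrightarrow> P \<noteq> [] \<Longrightarrow> 0 \<in> set (north_xs P)"
  by (cases "(0::nat, P)" rule: dyck_suffix.cases) auto

lemma run_eq_Least:
  assumes "dyck_suffix 0 P"
  shows "run P = (LEAST i. i \<notin> set (north_xs P))"
proof (cases "P = []")
  case False
  let ?n = "count_list P North"
  let ?l = "LEAST i. i \<notin> set (north_xs P)"
  have n: "?n \<notin> set (north_xs P)" using north_xs_less[OF assms] by blast
  have l: "?l \<notin> set (north_xs P)" using n by (rule LeastI)
  moreover have "?l \<noteq> 0" 
  proof
    assume "?l = 0"
    with l zero_in_north_xs[OF assms False] show False by simp
  qed
  moreover have "?l \<le> ?n" using n by (rule Least_le)
  ultimately have "Min {i \<in> {1..?n}. i \<notin> set (north_xs P)} = ?l"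
  proof (intro Min_eqI)
    fix i assume "i \<in> {i \<in> {1..?n}. i \<notin> set (north_xs P)}"
    then have "i \<notin> set (north_xs P)" by simp
    then show "?l \<le> i" by (rule Least_le)
  qed simp_all
  with False show ?thesis by (simp add: run_def length_north_xs)
qed (simp add: run_def)

text \<open>Here the x-coordinates are 0 and the successors of those of \<open>B\<close>, so the
  least missing value moves up by one.\<close>

lemma run_join_Nil:
  assumes "dyck_suffix 0 B"
  shows "run (North # East # B) = Suc (run B)"
proof -
  have B: "count_list B North \<notin> set (north_xs B)" using north_xs_less[OF assms] by blast
  have "(LEAST i. i \<notin> set (north_xs (North # East # B))) =
      Suc (LEAST i. Suc i \<notin> set (north_xs (North # East # B)))"
    by (rule Least_Suc[of _ "Suc (count_list B North)"]) (use B in auto)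
  then show ?thesis using assms by (simp add: run_eq_Least image_iff)
qed

text \<open>The initial North step only adds 0, which \<open>A\<close> already has, and those of
  \<open>B\<close> lie beyond the size of \<open>A\<close>, a value missing from \<open>A\<close>.
  So the least gap of \<open>A\<close> survives.\<close>

lemma run_join:
  assumes "dyck_suffix 0 A" "A \<noteq> []" "dyck_suffix 0 B"
  shows "run (North # A @ East # B) = run A"
proof -
  let ?l = "LEAST i. i \<notin> set (north_xs A)"
  have n: "count_list A North \<notin> set (north_xs A)" using north_xs_less[OF assms(1)] by blast
  have l: "?l \<notin> set (north_xs A)" using n by (rule LeastI)
  have le: "?l \<le> count_list A North" using n by (rule Least_le)
  have z: "0 \<in> set (north_xs A)" by (rule zero_in_north_xs[OF assms(1,2)])
  have S: "set (north_xs (North # A @ East # B)) =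
      set (north_xs A) \<union> (\<lambda>x. Suc (count_list A North + x)) ` set (north_xs B)"
    using dyck_suffix_count[OF assms(1)]
    by (simp add: north_xs_append image_image insert_absorb[OF z] flip: Un_insert_left)
  have "(LEAST i. i \<notin> set (north_xs (North # A @ East # B))) = ?l"
    unfolding S
  proof (rule Least_equality)
    fix i assume "i \<notin> set (north_xs A) \<union> (\<lambda>x. Suc (count_list A North + x)) ` set (north_xs B)"
    then have "i \<notin> set (north_xs A)" by simp
    then show "?l \<le> i" by (rule Least_le)
  next
    show "?l \<notin> set (north_xs A) \<union> (\<lambda>x. Suc (count_list A North + x)) ` set (north_xs B)"
      proof
      assume "?l \<in> set (north_xs A) \<union> (\<lambda>x. Suc (count_list A North + x)) ` set (north_xs B)"
      with l obtain x where "?l = Suc (count_list A North + x)" by blast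
      with le show False by simp
    qed
  qed
  moreover have "dyck_suffix 0 (North # A @ East # B)"
    using assms dyck_suffix_append_East[of 0 A 0 B] by simp
  then have "run (North # A @ East # B) = (LEAST i. i \<notin> set (north_xs (North # A @ East # B)))"
    by (rule run_eq_Least)
  ultimately show ?thesis unfolding run_eq_Least[OF assms(1)] by (rule trans[rotated])
qed

section \<open>Returns under the decomposition\<close>

text \<open>\<open>h\<close> is the height above the diagonal at which \<open>P\<close> starts.\<close>

definition ret_from :: "nat \<Rightarrow> step list \<Rightarrow> nat" where
  "ret_from h P = card {k. k < length P \<and> P ! k = North \<and> xpos P k = ypos P k + h}"

lemma card_less_Suc:
  "card {k. k < Suc n \<and> Q k} = (if Q 0 then 1 else 0) + card {k. k < n \<and> Q (Suc k)}"
proof -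
  have "{k. k < Suc n \<and> Q k} = (if Q 0 then {0} else {}) \<union> Suc ` {k. k < n \<and> Q (Suc k)}"
    by (auto simp: image_iff less_Suc_eq_0_disj)
  moreover have "card (Suc ` {k. k < n \<and> Q (Suc k)}) = card {k. k < n \<and> Q (Suc k)}"
    by (rule card_image) simp
  ultimately show ?thesis by (auto simp: card_insert_if)
qed

lemma ret_from_simps [simp]:
  "ret_from h [] = 0"
  "ret_from h (North # P) = (if h = 0 then 1 else 0) + ret_from (Suc h) P"
  "ret_from (Suc h) (East # P) = ret_from h P"
  by (simp_all add: ret_from_def card_less_Suc)

text \<open>Started one unit higher, \<open>A\<close> never touches the diagonal and ends at height
  1.\<close>

lemma ret_from_append:
  "dyck_suffix h A \<Longrightarrow> ret_from (Suc h) (A @ B) = ret_from 1 B"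
  by (induction h A rule: dyck_suffix.induct) auto

lemma ret_join:
  assumes "dyck_suffix 0 A"
  shows "ret (North # A @ East # B) = Suc (ret B)"
proof -
  have "ret_from 0 (North # A @ East # B) = Suc (ret_from 0 B)"
    using ret_from_append[OF assms] by simp
  then show ?thesis by (simp add: ret_from_def ret_def)
qed

section \<open>The functional equation and its solution\<close>

unbundle fps_syntax

lemma C_gf_nth_0: "C_gf p q $ 0 = 1"
  by (simp add: C_gf_def dyck_paths_0 run_def ret_def)

text \<open>For nonempty \<open>A\<close> neither the returns of \<open>A\<close> nor the run of
  \<open>B\<close> counts, which sets \<open>q\<close>, respectively \<open>p\<close>, to 1 in the
  two factors.\<close>

lemma C_gf_rec:
  fixes p q :: "'a::field_char_0"
  shows "C_gf p q = 1 + fps_X * (fps_const (p * q) * C_gf p q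
           + fps_const q * ((C_gf p 1 - 1) * C_gf 1 q))"
proof (rule fps_ext)
  fix n
  show "C_gf p q $ n = (1 + fps_X * (fps_const (p * q) * C_gf p q
           + fps_const q * ((C_gf p 1 - 1) * C_gf 1 q))) $ n"
  proof (cases n)
    case 0
    then show ?thesis by (simp add: C_gf_nth_0)
  next
    case (Suc m)
    \<comment> \<open>\<open>g i\<close> collects the paths whose component \<open>A\<close> has
      size \<open>i\<close>; only \<open>i = 0\<close> follows the other rule for the run.\<close>
    define g where "g i = (\<Sum>A\<in>dyck_paths i. \<Sum>B\<in>dyck_paths (m - i).
      p ^ run (North # A @ East # B) * q ^ ret (North # A @ East # B))" for i
    have g0: "g 0 = p * q * C_gf p q $ m"
      by (simp add: g_def dyck_paths_0 C_gf_def sum_distrib_left dyck_paths_iff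
        run_join_Nil ret_join[of "[]", simplified] ac_simps)
    have gi: "g i = q * ((C_gf p 1 - 1) $ i * C_gf 1 q $ (m - i))" if "i \<noteq> 0" for i
    proof -
      have "g i = (\<Sum>A\<in>dyck_paths i. \<Sum>B\<in>dyck_paths (m - i). q * (p ^ run A * q ^ ret B))"
        unfolding g_def
      proof (intro sum.cong refl)
        fix A B assume *: "A \<in> dyck_paths i" "B \<in> dyck_paths (m - i)"
        with that have "A \<noteq> []" by (auto simp: dyck_paths_iff)
        with * show "p ^ run (North # A @ East # B) * q ^ ret (North # A @ East # B) =
            q * (p ^ run A * q ^ ret B)"
          by (simp add: dyck_paths_iff run_join ret_join)
      qed
      also have "\<dots> = q * ((C_gf p 1 - 1) $ i * C_gf 1 q $ (m - i))"
        using that by (simp add: C_gf_def sum_product) (simp only: sum_distrib_left)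
      finally show ?thesis .
    qed
    have "C_gf p q $ n = (\<Sum>i\<le>m. g i)"
      by (simp add: C_gf_def Suc sum_dyck_paths_Suc g_def)
    also have "\<dots> = g 0 + (\<Sum>i\<in>{..m} - {0}. g i)"
      by (subst sum.remove[of _ 0]) auto
    also have "(\<Sum>i\<in>{..m} - {0}. g i) =
        (\<Sum>i\<in>{..m} - {0}. q * ((C_gf p 1 - 1) $ i * C_gf 1 q $ (m - i)))"
      by (rule sum.cong) (use gi in auto)
    \<comment> \<open>The term \<open>i = 0\<close> can be restored because
      \<open>C_gf p 1 - 1\<close> has constant coefficient 0.\<close>
    also have "\<dots> = (\<Sum>i\<le>m. q * ((C_gf p 1 - 1) $ i * C_gf 1 q $ (m - i)))"
      by (subst (2) sum.remove[of _ 0]) (auto simp: C_gf_nth_0)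
    also have "g 0 + \<dots> = p * q * C_gf p q $ m + q * ((C_gf p 1 - 1) * C_gf 1 q) $ m"
      by (simp only: g0 fps_mult_nth atLeast0AtMost sum_distrib_left)
    also have "\<dots> = (1 + fps_X * (fps_const (p * q) * C_gf p q
           + fps_const q * ((C_gf p 1 - 1) * C_gf 1 q))) $ n"
      by (simp add: Suc)
    finally show ?thesis .
  qed
qed

lemma C_gf_1_1: "C_gf 1 1 = 1 + fps_X * (C_gf 1 1)\<^sup>2"
  using C_gf_rec[of 1 1] by (simp add: algebra_simps power2_eq_square)

lemma C_gf_p_1:
  fixes p :: "'a::field_char_0"
  shows "C_gf p 1 * (1 - fps_const p * fps_X * C_gf 1 1) = 1"
proof -
  define R c P X where defs: "R = C_gf p 1" "c = (C_gf 1 1 :: 'a fps)" "P = fps_const p"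
    "X = (fps_X :: 'a fps)"
  have R: "R = 1 + X * (P * R + (R - 1) * c)" using C_gf_rec[of p 1] by (simp add: defs)
  have c: "c = 1 + X * c\<^sup>2" using C_gf_1_1 unfolding defs .
  \<comment> \<open>Multiply \<open>R * (1 - P * X - X * c) = 1 - X * c\<close> by \<open>c\<close>
    and use \<open>c * (1 - X * c) = 1\<close>.\<close>
  have "R * (1 - P * X * c) = 1" using R c by algebra
  then show ?thesis by (simp add: defs)
qed

lemma C_gf_1_q:
  fixes q :: "'a::field_char_0"
  shows "C_gf 1 q * (1 - fps_const q * fps_X * C_gf 1 1) = 1"
proof -
  have "C_gf 1 q = 1 + fps_X * (fps_const q * (C_gf 1 1 * C_gf 1 q))"
    using C_gf_rec[of 1 q] by (simp add: algebra_simps)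
  then show ?thesis by (simp add: algebra_simps)
qed

text \<open>By the Catalan equation both sides have square \<open>1 - 4 * fps_X\<close>; the
  constant coefficient 1 fixes the sign.\<close>

lemma sqrt_eq_C_gf:
  "(sqrt_1_minus_4t :: 'a::field_char_0 fps) = 1 - 2 * fps_X * C_gf 1 1"
proof -
  let ?S = "sqrt_1_minus_4t :: 'a fps" and ?U = "1 - 2 * fps_X * C_gf 1 1 :: 'a fps"
  have "?S\<^sup>2 = ?U\<^sup>2"
    using C_gf_1_1[where 'a = 'a] unfolding sqrt_1_minus_4t_power2 by algebra
  moreover have "?S \<noteq> - ?U"
  proof
    assume "?S = - ?U"
    then have "?S $ 0 = (- ?U) $ 0" by simp
    then show False by (simp add: sqrt_1_minus_4t_nth_0 mult.assoc)
  qed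
  ultimately show ?thesis by (simp add: power2_eq_iff)
qed

theorem theorem4p1:
  fixes p q :: "'a::field_char_0"
  shows "C_gf p q =
    (let t = fps_X; P = fps_const p; Q = fps_const q; S = sqrt_1_minus_4t in
      (2 * P * Q * (1 - t) - 2 * (P + Q) + 4 + 2 * (P + Q - P * Q - P * Q * t) * S)
      / ((1 - P * Q * t) * (2 - P + P * S) * (2 - Q + Q * S)))"
proof -
  define C R T c P Q X S where defs: "C = C_gf p q" "R = C_gf p 1" "T = C_gf 1 q"
    "c = (C_gf 1 1 :: 'a fps)" "P = fps_const p" "Q = fps_const q" "X = (fps_X :: 'a fps)"
    "S = (sqrt_1_minus_4t :: 'a fps)"
  have C: "C = 1 + X * (P * Q * C + Q * ((R - 1) * T))"
    using C_gf_rec[of p q] by (simp add: defs)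
  have c: "c = 1 + X * c\<^sup>2" using C_gf_1_1 unfolding defs .
  have R: "R * (1 - P * X * c) = 1" using C_gf_p_1 unfolding defs .
  have T: "T * (1 - Q * X * c) = 1" using C_gf_1_q unfolding defs .
  have S: "S = 1 - 2 * X * c" using sqrt_eq_C_gf unfolding defs .
  let ?N = "2 * P * Q * (1 - X) - 2 * (P + Q) + 4 + 2 * (P + Q - P * Q - P * Q * X) * S"
  let ?D = "(1 - P * Q * X) * (2 - P + P * S) * (2 - Q + Q * S)"
  \<comment> \<open>The factor 4 arises from \<open>2 - P + P * S = 2 * (1 - P * X * c)\<close> and
    its analogue for \<open>Q\<close>.\<close>
  have "C * ?D = 4 * ((1 - P * Q * X) * C * (1 - P * X * c) * (1 - Q * X * c))"
    unfolding S by algebra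
  \<comment> \<open>By \<open>C\<close>,
    \<open>(1 - P * Q * X) * C = 1 + X * Q * (R - 1) * T\<close>; moreover
    \<open>(R - 1) * (1 - P * X * c) = P * X * c\<close>, and \<open>T\<close> cancels.\<close>
  also have "(1 - P * Q * X) * C * (1 - P * X * c) * (1 - Q * X * c) =
      (1 - P * X * c) * (1 - Q * X * c) + P * Q * X * (X * c)"
    using C R T by algebra
  \<comment> \<open>The equation for \<open>c\<close> turns \<open>X\<^sup>2 * c\<^sup>2\<close>
    into \<open>X * c - X\<close>, leaving an expression linear in \<open>c\<close>, hence in
    \<open>S\<close>.\<close>
  also have "4 * \<dots> = ?N"
    unfolding S using c by algebra
  finally have "C * ?D = ?N" .
  \<comment> \<open>The nonzero constant coefficient shows \<open>?D \<noteq> 0\<close>, so that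
    \<open>?D\<close> may be cancelled.\<close>
  moreover have "?D $ 0 = 4"
    by (simp add: defs sqrt_1_minus_4t_nth_0 fps_numeral_nth_0)
  then have "?D \<noteq> 0" by (metis fps_zero_nth zero_neq_numeral)
  ultimately have "C = ?N / ?D" by (metis nonzero_mult_div_cancel_right)
  then show ?thesis unfolding Let_def defs .
qed

end
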